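(* Assume $\phi'(y)\ne0$ for all $y\in\mathbb{R}$. Then the double-forced multiparticle system $\dot x=f(x)+g^u(x)u+g^v(x)v$ on $\mathbb{R}^{2n}$, with $g^u=\frac{\partial}{\partial p_1}$ and $g^v=\frac{\partial}{\partial p_n}$, is locally state-feedback linearizable at each point $x^0\in\mathbb{R}^{2n}$.
   Context: Let $n\ge 2$. $\Phi:\mathbb{R}\to\mathbb{R}$ is a real analytic, bounded below function with $\lim_{y\to+\infty}\Phi(y)=+\infty$, and $\phi=\Phi'$. The state is $x=(q,p)=(q_1,\dots,q_n,p_1,\dots,p_n)\in\mathbb{R}^{2n}$. The drift is the vector field $$f=\sum_{k=1}^{n}p_k\frac{\partial}{\partial q_k}-\phi(q_1-q_2)\frac{\partial}{\partial p_1}+\sum_{k=2}^{n-1}\bigl(\phi(q_{k-1}-q_k)-\phi(q_k-q_{k+1})\bigr)\frac{\partial}{\partial p_k}+\phi(q_{n-1}-q_n)\frac{\partial}{\partial p_n}.$$ Definition. A control-affine system $\dot x=f(x)+G(x)w$ on $\mathbb{R}^N$ with $w\in\mathbb{R}^r$ (columns of $G$ being the controlled vector fields; here $N=2n$, $r=2$, $G=(g^u\ g^v)$) is locally state-feedback linearizable at $x^0$ if there exist (i) a smooth local feedback transformation $w=\alpha(x)+\beta(x)\bar w$, defined in a neighborhood of $x^0$, with $\beta(x)$ a nonsingular $r\times r$ matrix, producing $\bar f=f+G\alpha$ and $\bar G=G\beta$; and (ii) a local (at $x^0$) diffeomorphism $P:x\mapsto y$ into $\mathbb{R}^N$, such that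 $P_*\bar f(y)=Ay$ and $P_*\bar G(y)=B$, where $A$ is a constant $N\times N$ matrix and $B=(b^1\ \dots\ b^r)$ has constant columns. It is not required that $P(x^0)=0$. *)

theory Defs
  imports "HOL-Analysis.Analysis"
begin

section \<open>Smoothness and real analyticity\<close>

text \<open>On an open set \<open>S\<close>, \<open>Ck_on k f S\<close> says that \<open>f\<close> is \<open>k\<close> times continuously
  differentiable: \<open>f\<close> is differentiable and each directional derivative \<open>x \<mapsto> Df(x) v\<close>
  is \<open>k - 1\<close> times continuously differentiable.\<close>

primrec Ck_on ::
  "nat \<Rightarrow> ('a::euclidean_space \<Rightarrow> 'b::real_normed_vector) \<Rightarrow> 'a set \<Rightarrow> bool"
where
  "Ck_on 0 = (\<lambda>f S. continuous_on S f)"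
| "Ck_on (Suc k) = (\<lambda>f S.
     (\<forall>x\<in>S. f differentiable (at x)) \<and>
     (\<forall>v. Ck_on k (\<lambda>x. frechet_derivative f (at x) v) S))"

definition smooth_on ::
  "('a::euclidean_space \<Rightarrow> 'b::real_normed_vector) \<Rightarrow> 'a set \<Rightarrow> bool"
where
  "smooth_on f S \<longleftrightarrow> (\<forall>k. Ck_on k f S)"

definition real_analytic :: "(real \<Rightarrow> real) \<Rightarrow> bool" where
  "real_analytic F \<longleftrightarrow>
     (\<forall>x. \<exists>r>0. \<exists>a. \<forall>y. \<bar>y - x\<bar> < r \<longrightarrow> (\<lambda>k. a k * (y - x) ^ k) sums F y)"


section \<open>Local state-feedback linearizability\<close>

definition diffeomorphism ::
  "(real^'N) set \<Rightarrow> (real^'N) set \<Rightarrow> (real^'N \<Rightarrow> real^'N) \<Rightarrow> (real^'N \<Rightarrow> real^'N) \<Rightarrow> bool"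
where
  "diffeomorphism U V P Q \<longleftrightarrow>
     open U \<and> open V \<and> homeomorphism U V P Q \<and> smooth_on P U \<and> smooth_on Q V"

text \<open>The vector field \<open>P\<^sub>* X\<close>, where \<open>Q\<close> is the inverse of \<open>P\<close>.\<close>

definition pushforward ::
  "(real^'N \<Rightarrow> real^'N) \<Rightarrow> (real^'N \<Rightarrow> real^'N) \<Rightarrow> (real^'N \<Rightarrow> real^'N) \<Rightarrow> real^'N \<Rightarrow> real^'N"
where
  "pushforward P Q X y = frechet_derivative P (at (Q y)) (X (Q y))"

text \<open>The system is \<open>x' = f(x) + G(x) w\<close> on \<open>\<real>\<^sup>N\<close>; the columns of \<open>G x\<close> are the controlled
  vector fields, so \<open>G x\<close> is an \<open>N \<times> r\<close> matrix. The feedback and the change of coordinates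
  are taken on a common neighbourhood \<open>U\<close> of \<open>x0\<close>, which is no restriction as both are local.\<close>

definition locally_state_feedback_linearizable ::
  "(real^'N \<Rightarrow> real^'N) \<Rightarrow> (real^'N \<Rightarrow> real^'r^'N) \<Rightarrow> real^'N \<Rightarrow> bool"
where
  "locally_state_feedback_linearizable f G x0 \<longleftrightarrow>
     (\<exists>U V (\<alpha> :: real^'N \<Rightarrow> real^'r) (\<beta> :: real^'N \<Rightarrow> real^'r^'r) P Q
        (A :: real^'N^'N) (B :: real^'r^'N).
        x0 \<in> U \<and> smooth_on \<alpha> U \<and> smooth_on \<beta> U \<and> (\<forall>x\<in>U. invertible (\<beta> x)) \<and>
        diffeomorphism U V P Q \<and>
        (\<forall>y\<in>V. pushforward P Q (\<lambda>x. f x + G x *v \<alpha> x) y = A *v y) \<and>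
        (\<forall>y\<in>V. \<forall>j. pushforward P Q (\<lambda>x. column j (G x ** \<beta> x)) y = column j B))"


section \<open>The multiparticle system\<close>

text \<open>The state space \<open>\<real>\<^sup>2\<^sup>n\<close> is \<open>real^('n + 'n)\<close>, with positions in the \<open>Inl\<close> and momenta in the
  \<open>Inr\<close> coordinates. The map \<open>e\<close> numbers the particles: it is meant to be a bijection from
  \<open>{1..n}\<close> to \<open>'n\<close>, so that particle \<open>k\<close> has position \<open>x $ Inl (e k)\<close> and momentum
  \<open>x $ Inr (e k)\<close>.\<close>

definition pos :: "(nat \<Rightarrow> 'n::finite) \<Rightarrow> real^('n + 'n) \<Rightarrow> nat \<Rightarrow> real" where
  "pos e x k = x $ Inl (e k)"

definition mom :: "(nat \<Rightarrow> 'n::finite) \<Rightarrow> real^('n + 'n) \<Rightarrow> nat \<Rightarrow> real" where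
  "mom e x k = x $ Inr (e k)"

text \<open>The constant coordinate vector fields \<open>\<partial>/\<partial>q\<^sub>k\<close> and \<open>\<partial>/\<partial>p\<^sub>k\<close>.\<close>

definition d_pos :: "(nat \<Rightarrow> 'n::finite) \<Rightarrow> nat \<Rightarrow> real^('n + 'n)" where
  "d_pos e k = axis (Inl (e k)) 1"

definition d_mom :: "(nat \<Rightarrow> 'n::finite) \<Rightarrow> nat \<Rightarrow> real^('n + 'n)" where
  "d_mom e k = axis (Inr (e k)) 1"

definition drift ::
  "(real \<Rightarrow> real) \<Rightarrow> nat \<Rightarrow> (nat \<Rightarrow> 'n::finite) \<Rightarrow> real^('n + 'n) \<Rightarrow> real^('n + 'n)"
where
  "drift \<phi> n e x =
     (\<Sum>k=1..n. mom e x k *\<^sub>R d_pos e k)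
     - \<phi> (pos e x 1 - pos e x 2) *\<^sub>R d_mom e 1
     + (\<Sum>k=2..n-1. (\<phi> (pos e x (k - 1) - pos e x k) - \<phi> (pos e x k - pos e x (k + 1)))
                    *\<^sub>R d_mom e k)
     + \<phi> (pos e x (n - 1) - pos e x n) *\<^sub>R d_mom e n"

text \<open>The \<open>2n \<times> 2\<close> matrix field with columns \<open>g\<^sup>u = \<partial>/\<partial>p\<^sub>1\<close> and \<open>g\<^sup>v = \<partial>/\<partial>p\<^sub>n\<close>.\<close>

definition double_forcing ::
  "nat \<Rightarrow> (nat \<Rightarrow> 'n::finite) \<Rightarrow> real^('n + 'n) \<Rightarrow> real^2^('n + 'n)"
where
  "double_forcing n e x = (\<chi> i j. (if j = 1 then d_mom e 1 else d_mom e n) $ i)"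

end

theory Submission
  imports Defs
begin

text \<open>
  Cut the chain in the middle, at \<open>m = \<lceil>n/2\<rceil>\<close>, and take \<open>q\<^sub>m\<close> and \<open>q\<^sub>m\<^sub>+\<^sub>1\<close> as flat
  outputs. Two time derivatives of an output involve one more particle on either side, and since
  \<open>\<phi>'\<close> never vanishes the newly involved coordinate can be solved for. The forcing is thus reached
  from \<open>q\<^sub>m\<close> after \<open>2m\<close> and from \<open>q\<^sub>m\<^sub>+\<^sub>1\<close> after \<open>2(n - m)\<close> differentiations, so the derivatives of
  lower order are \<open>2n\<close> functions with triangular, invertible Jacobian: by the inverse function
  theorem they are local coordinates. In these the system is a pair of integrator chains, up to
  the top derivatives, which are affine in the controls with an invertible decoupling matrix and
  can be cancelled by feedback. Cutting in the middle matters: if the two chains differed in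
  length by more than two, the control of the shorter one would appear too early in the other.
\<close>

section \<open>Smooth maps\<close>

lemma Ck_on_SucD:
  assumes "Ck_on (Suc k) f S" "x \<in> S"
  shows "(f has_derivative frechet_derivative f (at x)) (at x)"
  using assms by (simp add: frechet_derivative_works)

text \<open>\<open>frechet_derivative\<close> at a point of an open set depends only on the values
  nearby, so the agreement passes to all derivatives.\<close>

lemma Ck_on_cong:
  assumes "open S" "\<And>x. x \<in> S \<Longrightarrow> f x = g x"
  shows "Ck_on k f S \<longleftrightarrow> Ck_on k g S"
proof -
  have "Ck_on k g S" if "open S" "\<And>x. x \<in> S \<Longrightarrow> f x = g x" "Ck_on k f S" for f g
    using that
  proof (induction k arbitrary: f g)
    case 0
    then show ?case by (simp cong: continuous_on_cong)
  next
    case (Suc k)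
    have D: "(g has_derivative frechet_derivative f (at x)) (at x)" if "x \<in> S" for x
      using Ck_on_SucD[OF Suc.prems(3) that] Suc.prems(1) that
      by (rule has_derivative_transform_within_open) (use Suc.prems(2) in simp)
    then have "frechet_derivative f (at x) v = frechet_derivative g (at x) v" if "x \<in> S" for x v
      using frechet_derivative_at[OF D[OF that]] by simp
    then have "Ck_on k (\<lambda>x. frechet_derivative g (at x) v) S" for v
      using Suc.IH[of "\<lambda>x. frechet_derivative f (at x) v"] Suc.prems(1,3) by simp
    with D show ?case by (auto simp: differentiable_def)
  qed
  from this[of f g] this[of g f] show ?thesis
    using assms by auto
qed

text \<open>The working rule for the closure properties below: by uniqueness of derivatives any
  explicit formula may replace \<open>frechet_derivative\<close>.\<close>

lemma Ck_on_SucI: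
  assumes "open S" and D: "\<And>x. x \<in> S \<Longrightarrow> (f has_derivative f' x) (at x)"
    and "\<And>v. Ck_on k (\<lambda>x. f' x v) S"
  shows "Ck_on (Suc k) f S"
proof -
  have "f' x v = frechet_derivative f (at x) v" if "x \<in> S" for x v
    using frechet_derivative_at[OF D[OF that]] by simp
  then have "Ck_on k (\<lambda>x. frechet_derivative f (at x) v) S" for v
    using Ck_on_cong[OF assms(1), of "\<lambda>x. f' x v" "\<lambda>x. frechet_derivative f (at x) v" k] assms(3)[of v]
    by simp
  with D show ?thesis by (auto simp: differentiable_def)
qed

lemma Ck_on_Suc_imp: "Ck_on (Suc k) f S \<Longrightarrow> Ck_on k f S"
proof (induction k arbitrary: f)
  case 0
  then show ?case
    by (auto intro!: continuous_at_imp_continuous_on differentiable_imp_continuous_within)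
next
  case (Suc k)
  then show ?case
    unfolding Ck_on.simps(2)[of "Suc k"] by (subst Ck_on.simps(2)) blast
qed

lemma Ck_on_subset: "Ck_on k f T \<Longrightarrow> S \<subseteq> T \<Longrightarrow> Ck_on k f S"
  by (induction k arbitrary: f) (auto intro: continuous_on_subset)

lemma Ck_on_const: "open S \<Longrightarrow> Ck_on k (\<lambda>x. c) S"
proof (induction k arbitrary: c)
  case (Suc k)
  show ?case
    by (rule Ck_on_SucI[where f' = "\<lambda>_ _. 0"]) (use Suc in auto)
qed auto

lemma Ck_on_bounded_linear:
  assumes T: "bounded_linear T" and "open S"
  shows "Ck_on k f S \<Longrightarrow> Ck_on k (\<lambda>x. T (f x)) S"
proof (induction k arbitrary: f)
  case 0
  then show ?case
    using bounded_linear.continuous_on[OF T] by simp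
next
  case (Suc k)
  show ?case
  proof (rule Ck_on_SucI[OF \<open>open S\<close>])
    fix x assume "x \<in> S"
    show "((\<lambda>x. T (f x)) has_derivative (\<lambda>v. T (frechet_derivative f (at x) v))) (at x)"
      by (rule bounded_linear.has_derivative[OF T Ck_on_SucD[OF Suc.prems \<open>x \<in> S\<close>]])
  next
    fix v show "Ck_on k (\<lambda>x. T (frechet_derivative f (at x) v)) S"
      using Suc by simp
  qed
qed

lemma Ck_on_linear:
  assumes T: "bounded_linear T" and "open S"
  shows "Ck_on k T S"
proof -
  have "Ck_on k (\<lambda>x. x) S"
  proof (cases k)
    case (Suc j)
    show ?thesis unfolding Suc
      by (rule Ck_on_SucI[where f' = "\<lambda>_ v. v"]) (use assms Ck_on_const in auto)
  qed auto
  from Ck_on_bounded_linear[OF assms this] show ?thesis .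
qed

lemma Ck_on_add:
  assumes "open S"
  shows "Ck_on k f S \<Longrightarrow> Ck_on k g S \<Longrightarrow> Ck_on k (\<lambda>x. f x + g x) S"
proof (induction k arbitrary: f g)
  case 0
  then show ?case by (auto intro: continuous_intros)
next
  case (Suc k)
  show ?case
  proof (rule Ck_on_SucI[OF \<open>open S\<close>])
    fix x assume x: "x \<in> S"
    show "((\<lambda>x. f x + g x) has_derivative
        (\<lambda>v. frechet_derivative f (at x) v + frechet_derivative g (at x) v)) (at x)"
      by (intro has_derivative_add Ck_on_SucD[OF Suc.prems(1) x] Ck_on_SucD[OF Suc.prems(2) x])
  qed (use Suc in auto)
qed

lemma Ck_on_diff:
  assumes "open S" "Ck_on k f S" "Ck_on k g S"
  shows "Ck_on k (\<lambda>x. f x - g x) S"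
  using Ck_on_add[OF assms(1,2) Ck_on_bounded_linear[OF bounded_linear_minus[OF bounded_linear_ident] assms(1,3)]]
  by simp

lemma Ck_on_sum:
  assumes "open S" "\<And>i. i \<in> I \<Longrightarrow> Ck_on k (f i) S"
  shows "Ck_on k (\<lambda>x. \<Sum>i\<in>I. f i x) S"
  using assms(2)
  by (induction I rule: infinite_finite_induct) (auto intro: Ck_on_const Ck_on_add assms(1))

text \<open>Product rule. Each term pairs a derivative with an undifferentiated factor, which is
  \<open>k\<close> times continuously differentiable by \<open>Ck_on_Suc_imp\<close>.\<close>

lemma Ck_on_bilinear:
  assumes B: "bounded_bilinear B" and "open S"
  shows "Ck_on k f S \<Longrightarrow> Ck_on k g S \<Longrightarrow> Ck_on k (\<lambda>x. B (f x) (g x)) S"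
proof (induction k arbitrary: f g)
  case 0
  then show ?case using bounded_bilinear.continuous_on[OF B] by auto
next
  case (Suc k)
  have *: "Ck_on k f S" "Ck_on k g S"
    using Suc.prems Ck_on_Suc_imp by blast+
  show ?case
  proof (rule Ck_on_SucI[OF \<open>open S\<close>])
    fix x assume x: "x \<in> S"
    show "((\<lambda>x. B (f x) (g x)) has_derivative
        (\<lambda>v. B (f x) (frechet_derivative g (at x) v) + B (frechet_derivative f (at x) v) (g x))) (at x)"
      by (rule bounded_bilinear.FDERIV[OF B Ck_on_SucD[OF Suc.prems(1) x] Ck_on_SucD[OF Suc.prems(2) x]])
  qed (use Suc * in \<open>auto intro!: Ck_on_add assms(2)\<close>)
qed

lemmas Ck_on_scaleR = Ck_on_bilinear[OF bounded_bilinear_scaleR]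
lemmas Ck_on_mult = Ck_on_bilinear[OF bounded_bilinear_mult]

lemma Ck_on_prod:
  fixes f :: "'i \<Rightarrow> 'a::euclidean_space \<Rightarrow> real"
  assumes "open S" "\<And>i. i \<in> I \<Longrightarrow> Ck_on k (f i) S"
  shows "Ck_on k (\<lambda>x. \<Prod>i\<in>I. f i x) S"
  using assms(2)
  by (induction I rule: infinite_finite_induct) (auto intro: Ck_on_const Ck_on_mult assms(1))

text \<open>The derivative of \<open>1/f\<close> is a product of \<open>1/f\<close>,
  \<open>1/f\<close> and a derivative of \<open>f\<close>, so the induction hypothesis applies to
  its own output.\<close>

lemma Ck_on_inverse:
  fixes f :: "'a::euclidean_space \<Rightarrow> real"
  assumes "open S" and nz: "\<And>x. x \<in> S \<Longrightarrow> f x \<noteq> 0"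
  shows "Ck_on k f S \<Longrightarrow> Ck_on k (\<lambda>x. inverse (f x)) S"
proof (induction k)
  case 0
  then show ?case using nz by (auto intro: continuous_intros)
next
  case (Suc k)
  have *: "Ck_on k (\<lambda>x. inverse (f x)) S"
    using Suc Ck_on_Suc_imp by blast
  show ?case
  proof (rule Ck_on_SucI[OF \<open>open S\<close>])
    fix x assume x: "x \<in> S"
    show "((\<lambda>x. inverse (f x)) has_derivative
        (\<lambda>v. -1 * (inverse (f x) * frechet_derivative f (at x) v * inverse (f x)))) (at x)"
      using Deriv.has_derivative_inverse[OF nz[OF x] Ck_on_SucD[OF Suc.prems x]] by simp
  next
    show "Ck_on k (\<lambda>x. -1 * (inverse (f x) * frechet_derivative f (at x) v * inverse (f x))) S" for v
      using Suc.prems by (intro Ck_on_const Ck_on_mult assms(1) *) simp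
  qed
qed

text \<open>In the chain rule the derivative of \<open>g\<close> is applied to a vector that varies
  with \<open>x\<close>, while \<open>Ck_on\<close> speaks of fixed directions. Expanding that
  vector over \<open>Basis\<close> leaves sums of products with fixed directions.\<close>

lemma Ck_on_compose:
  fixes g :: "'b::euclidean_space \<Rightarrow> 'c::real_normed_vector"
    and f :: "'a::euclidean_space \<Rightarrow> 'b"
  assumes "open S" "f ` S \<subseteq> T"
  shows "Ck_on k g T \<Longrightarrow> Ck_on k f S \<Longrightarrow> Ck_on k (\<lambda>x. g (f x)) S"
proof (induction k arbitrary: g)
  case 0
  then show ?case using continuous_on_compose2[of T g S f] assms(2) by simp
next
  case (Suc k)
  have f: "Ck_on k f S"
    using Suc.prems Ck_on_Suc_imp by blast
  show ?case
  proof (rule Ck_on_SucI[OF \<open>open S\<close>])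
    fix x assume x: "x \<in> S"
    then have g: "(g has_derivative frechet_derivative g (at (f x))) (at (f x))"
      using Ck_on_SucD[OF Suc.prems(1)] assms(2) by blast
    have "frechet_derivative g (at (f x)) w =
        (\<Sum>b\<in>Basis. (w \<bullet> b) *\<^sub>R frechet_derivative g (at (f x)) b)" for w
    proof -
      interpret linear "frechet_derivative g (at (f x))"
        using g has_derivative_linear by blast
      have "frechet_derivative g (at (f x)) (\<Sum>b\<in>Basis. (w \<bullet> b) *\<^sub>R b) =
          (\<Sum>b\<in>Basis. (w \<bullet> b) *\<^sub>R frechet_derivative g (at (f x)) b)"
        by (simp only: sum scale)
      then show ?thesis by (simp only: euclidean_representation)
    qed
    note expand = this
    show "((\<lambda>x. g (f x)) has_derivative
        (\<lambda>v. \<Sum>b\<in>Basis. (frechet_derivative f (at x) v \<bullet> b) *\<^sub>R frechet_derivative g (at (f x)) b)) (at x)"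
      unfolding expand[symmetric]
      by (rule has_derivative_compose[OF Ck_on_SucD[OF Suc.prems(2) x] g])
  next
    fix v
    have "Ck_on k (\<lambda>x. frechet_derivative g (at (f x)) b) S" for b
      using Suc.IH[of "\<lambda>y. frechet_derivative g (at y) b"] Suc.prems(1) f by simp
    moreover have "Ck_on k (\<lambda>x. frechet_derivative f (at x) v \<bullet> b) S" for b
      using Suc.prems(2) by (intro Ck_on_bounded_linear[OF bounded_linear_inner_left] assms(1)) simp
    ultimately show "Ck_on k (\<lambda>x. \<Sum>b\<in>Basis. (frechet_derivative f (at x) v \<bullet> b) *\<^sub>R
        frechet_derivative g (at (f x)) b) S"
      by (intro Ck_on_sum Ck_on_scaleR assms(1))
  qed
qed

section \<open>Vector- and matrix-valued maps\<close>

lemma bounded_linear_axis: "bounded_linear (axis i :: 'b::real_normed_vector \<Rightarrow> 'b^'n)"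
proof
  show "\<exists>K. \<forall>x::'b. norm (axis i x :: 'b^'n) \<le> norm x * K"
  proof (intro exI allI)
    fix x :: 'b
    have "norm (axis i x :: 'b^'n) \<le> (\<Sum>j\<in>UNIV. norm ((axis i x :: 'b^'n) $ j))"
      by (simp add: norm_vec_def L2_set_le_sum)
    also have "\<dots> = norm x"
      by (simp add: axis_def if_distrib[of norm] cong: if_cong)
    finally show "norm (axis i x :: 'b^'n) \<le> norm x * 1" by simp
  qed
qed (auto simp: axis_def vec_eq_iff)

text \<open>For the converse, the map is the sum of its components, each embedded by the linear map
  \<open>axis i\<close>.\<close>

lemma Ck_on_vec:
  fixes f :: "'a::euclidean_space \<Rightarrow> 'b::real_normed_vector^'n"
  assumes "open S"
  shows "Ck_on k f S \<longleftrightarrow> (\<forall>i. Ck_on k (\<lambda>x. f x $ i) S)"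
proof
  assume R: "\<forall>i. Ck_on k (\<lambda>x. f x $ i) S"
  have "f = (\<lambda>x. \<Sum>i\<in>UNIV. axis i (f x $ i))"
    by (simp add: fun_eq_iff vec_eq_iff axis_def if_distrib cong: if_cong)
  moreover have "Ck_on k (\<lambda>x. \<Sum>i\<in>UNIV. axis i (f x $ i)) S"
    using R by (intro Ck_on_sum Ck_on_bounded_linear[OF bounded_linear_axis] assms) simp
  ultimately show "Ck_on k f S" by simp
qed (simp add: Ck_on_bounded_linear[OF bounded_linear_vec_nth] assms)

lemma Ck_on_det:
  fixes M :: "'a::euclidean_space \<Rightarrow> real^'n^'n"
  assumes "open S" "\<And>i j. Ck_on k (\<lambda>x. M x $ i $ j) S"
  shows "Ck_on k (\<lambda>x. det (M x)) S"
  unfolding det_def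
  by (intro Ck_on_sum Ck_on_mult Ck_on_prod Ck_on_const assms)

lemma invertible_matrix_inv:
  fixes A :: "real^'n^'n"
  assumes "invertible A"
  shows "A ** matrix_inv A = mat 1" and "matrix_inv A ** A = mat 1"
  using assms unfolding invertible_def matrix_inv_def by (rule someI2_ex; simp)+

text \<open>By Cramer's rule the entries are quotients of determinants. The matrix
  \<open>?C x\<close> in the proof is \<open>M x\<close> with column \<open>i\<close> replaced by
  the \<open>l\<close>-th unit vector.\<close>

lemma Ck_on_matrix_inv:
  fixes M :: "'a::euclidean_space \<Rightarrow> real^'n^'n"
  assumes "open S" and M: "\<And>i j. Ck_on k (\<lambda>x. M x $ i $ j) S"
    and inv: "\<And>x. x \<in> S \<Longrightarrow> invertible (M x)"
  shows "Ck_on k (\<lambda>x. matrix_inv (M x)) S"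
proof -
  have "Ck_on k (\<lambda>x. matrix_inv (M x) $ i $ l) S" for i l
  proof -
    let ?C = "\<lambda>x. \<chi> a j. if j = i then (axis l 1 :: real^'n) $ a else M x $ a $ j"
    have "matrix_inv (M x) $ i $ l = det (?C x) * inverse (det (M x))" if "x \<in> S" for x
    proof -
      have "M x *v (matrix_inv (M x) *v axis l 1) = axis l 1"
        using invertible_matrix_inv(1)[OF inv[OF that]] by (simp add: matrix_vector_mul_assoc)
      moreover have "det (M x) \<noteq> 0"
        using inv[OF that] invertible_det_nz by blast
      ultimately have "(matrix_inv (M x) *v axis l 1) $ i = det (?C x) / det (M x)"
        by (simp add: cramer)
      then show ?thesis
        by (simp add: matrix_vector_mult_basis column_def divide_inverse)
    qed
    moreover have "Ck_on k (\<lambda>x. det (?C x) * inverse (det (M x))) S"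
    proof (intro Ck_on_mult Ck_on_inverse Ck_on_det assms(1) M)
      show "Ck_on k (\<lambda>x. ?C x $ a $ j) S" for a j
        using M Ck_on_const[OF assms(1)] by (cases "j = i") auto
      show "det (M x) \<noteq> 0" if "x \<in> S" for x
        using inv[OF that] invertible_det_nz by blast
    qed
    ultimately show ?thesis
      using Ck_on_cong[OF assms(1), of "\<lambda>x. matrix_inv (M x) $ i $ l"] by simp
  qed
  then show ?thesis
    by (simp add: Ck_on_vec[OF assms(1)])
qed

section \<open>The smooth inverse function theorem\<close>

text \<open>The inverse function theorem gives a differentiable local inverse \<open>Q\<close>. Its
  derivative at \<open>y\<close> is the inverse of the derivative of \<open>P\<close> at
  \<open>Q y\<close>, so each order of smoothness of \<open>Q\<close> yields the next one.\<close>

lemma smooth_inverse_function: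
  fixes P :: "real^'n \<Rightarrow> real^'n"
  assumes P: "smooth_on P UNIV"
    and inj: "\<And>x v. frechet_derivative P (at x) v = 0 \<Longrightarrow> v = 0"
  obtains U V Q where "x0 \<in> U" "diffeomorphism U V P Q"
proof -
  have Ck: "Ck_on k P UNIV" for k
    using P by (simp add: smooth_on_def)
  let ?D = "\<lambda>x. frechet_derivative P (at x)"
  define f' where "f' x = Blinfun (?D x)" for x
  have D: "(P has_derivative ?D x) (at x)" for x
    by (rule Ck_on_SucD[OF Ck UNIV_I])
  then have f': "blinfun_apply (f' x) = ?D x" for x
    unfolding f'_def using D has_derivative_bounded_linear bounded_linear_Blinfun_apply by blast
  have lin: "linear (?D x)" for x
    using D has_derivative_linear by blast
  have cont: "continuous_on UNIV f'"
  proof (rule continuous_on_blinfun_componentwise)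
    show "continuous_on UNIV (\<lambda>x. blinfun_apply (f' x) i)" for i
      using Ck[of "Suc 0"] by (simp add: f')
  qed
  obtain g where g: "linear g" "g \<circ> ?D x0 = id"
    using linear_injective_left_inverse[OF lin] inj linear_injective_0[OF lin] by blast
  then have inv: "Blinfun g o\<^sub>L f' x0 = id_blinfun"
    by (intro blinfun_eqI) (simp add: f' bounded_linear_Blinfun_apply linear_conv_bounded_linear o_def fun_eq_iff)
  have D': "(P has_derivative blinfun_apply (f' x)) (at x)" for x
    using D by (simp add: f')
  obtain U V Q g' where UV: "open U" "x0 \<in> U" "open V" "homeomorphism U V P Q"
    and Q: "\<And>y. y \<in> V \<Longrightarrow> (Q has_derivative (g' y)) (at y)"
    and g': "\<And>y. y \<in> V \<Longrightarrow> g' y = inv (blinfun_apply (f'(Q y)))"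
    using inverse_function_theorem[OF open_UNIV D' cont UNIV_I inv] by metis
  define M where "M x = matrix (?D x)" for x
  have M: "M x *v v = ?D x v" for x v
    unfolding M_def using lin by (simp add: matrix_works)
  have Minv: "invertible (M x)" for x
    unfolding invertible_left_inverse matrix_left_invertible_ker
    using inj by (simp add: M)
  \<comment> \<open>The derivative of \<open>Q\<close> is given as the inverse of a function; as a
    matrix inverse it falls under \<open>Ck_on_matrix_inv\<close>.\<close>
  have "g' y v = matrix_inv (M (Q y)) *v v" if "y \<in> V" for y v
  proof -
    have "?D (Q y) (matrix_inv (M (Q y)) *v v) = v"
      using invertible_matrix_inv(1)[OF Minv] by (simp flip: M add: matrix_vector_mul_assoc)
    moreover have "inj (?D (Q y))"
      using inj linear_injective_0[OF lin] by blast
    ultimately show ?thesis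
      by (simp add: g'[OF that] f' inv_f_eq)
  qed
  note g' = this
  have "Ck_on k Q V" for k
  proof (induction k)
    case 0
    then show ?case using UV(4) by (simp add: homeomorphism_def)
  next
    case (Suc k)
    show ?case
    proof (rule Ck_on_SucI[OF \<open>open V\<close> Q])
      fix v
      have "Ck_on k (\<lambda>y. M (Q y) $ i $ j) V" for i j
      proof (rule Ck_on_compose[OF \<open>open V\<close> subset_UNIV _ Suc])
        show "Ck_on k (\<lambda>x. M x $ i $ j) UNIV"
          using Ck[of "Suc k"] by (simp add: M_def matrix_def Ck_on_vec)
      qed
      then have "Ck_on k (\<lambda>y. matrix_inv (M (Q y))) V"
        by (intro Ck_on_matrix_inv \<open>open V\<close> Minv)
      then have "Ck_on k (\<lambda>y. matrix_inv (M (Q y)) *v v) V"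
        by (simp add: Ck_on_vec[OF \<open>open V\<close>] matrix_vector_mult_def)
          (auto intro!: Ck_on_sum Ck_on_mult Ck_on_const \<open>open V\<close>)
      then show "Ck_on k (\<lambda>y. g' y v) V"
        using Ck_on_cong[OF \<open>open V\<close>, of "\<lambda>y. g' y v"] g' by simp
    qed
  qed
  then have "diffeomorphism U V P Q"
    using UV P Ck_on_subset[OF Ck] unfolding diffeomorphism_def smooth_on_def by auto
  then show thesis using that UV by blast
qed

section \<open>Real analytic functions\<close>

text \<open>Termwise differentiation: \<open>diffs a\<close> is the coefficient sequence of the
  derivative, and its series converges on the same interval.\<close>

lemma real_analytic_deriv:
  assumes "real_analytic F"
  shows "real_analytic (deriv F)" and "\<And>x. (F has_real_derivative deriv F x) (at x)"
proof -
  have *: "\<exists>r>0. \<exists>a. \<forall>y. \<bar>y - x\<bar> < r \<longrightarrow> (F has_real_derivative deriv F y) (at y) \<and>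
      (\<lambda>k. a k * (y - x) ^ k) sums deriv F y" for x
  proof -
    obtain r a where r: "r > 0" and a: "\<And>y. \<bar>y - x\<bar> < r \<Longrightarrow> (\<lambda>k. a k * (y - x) ^ k) sums F y"
      using assms unfolding real_analytic_def by metis
    have S: "(\<lambda>k. a k * z ^ k) sums F (x + z)" if "norm z < r" for z
      using a[of "x + z"] that by simp
    have "(F has_real_derivative deriv F y) (at y) \<and>
      (\<lambda>k. diffs a k * (y - x) ^ k) sums deriv F y" if y: "\<bar>y - x\<bar> < r" for y
    proof -
      let ?d = "\<Sum>n. diffs a n * (y - x) ^ n"
      have y': "norm (y - x) < r" using y by simp
      have "((\<lambda>z. \<Sum>n. a n * z ^ n) has_real_derivative ?d) (at (y - x))"
        using S y' by (intro termdiffs_strong'[of r]) (auto simp: sums_iff)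
      then have 1: "((\<lambda>z. F (x + z)) has_real_derivative ?d) (at (y - x))"
        by (rule has_field_derivative_transform_within_open[where S = "ball 0 r"])
          (use S y' in \<open>auto simp: sums_iff\<close>)
      then have d: "(F has_real_derivative ?d) (at y)"
        using DERIV_shift[of F ?d "y - x" x] by (simp add: add.commute)
      have "(\<lambda>k. diffs a k * (y - x) ^ k) sums ?d"
        by (rule termdiffs_sums_strong[OF S 1 y'])
      with d show ?thesis
        using DERIV_imp_deriv[OF d] by simp
    qed
    with r show ?thesis by (intro exI[of _ r] conjI exI[of _ "diffs a"]) simp_all
  qed
  show "real_analytic (deriv F)"
    unfolding real_analytic_def
  proof
    fix x
    obtain r a where "r > 0" "\<And>y. \<bar>y - x\<bar> < r \<Longrightarrow> (\<lambda>k. a k * (y - x) ^ k) sums deriv F y"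
      using *[of x] by blast
    then show "\<exists>r>0. \<exists>a. \<forall>y. \<bar>y - x\<bar> < r \<longrightarrow> (\<lambda>k. a k * (y - x) ^ k) sums deriv F y"
      by (intro exI[of _ r] conjI exI[of _ a]) simp_all
  qed
  show "(F has_real_derivative deriv F x) (at x)" for x
  proof -
    obtain r where "r > 0" "\<And>y. \<bar>y - x\<bar> < r \<Longrightarrow> (F has_real_derivative deriv F y) (at y)"
      using *[of x] by blast
    then show ?thesis by simp
  qed
qed

lemma real_analytic_imp_smooth:
  assumes "real_analytic F"
  shows "smooth_on F UNIV"
proof -
  have "Ck_on k F UNIV" if "real_analytic F" for F k
    using that
  proof (induction k arbitrary: F)
    case 0
    then show ?case
      using real_analytic_deriv(2)[OF 0] by (auto intro!: continuous_at_imp_continuous_on DERIV_isCont)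
  next
    case (Suc k)
    show ?case
    proof (rule Ck_on_SucI[OF open_UNIV])
      show "(F has_derivative (\<lambda>v. deriv F x * v)) (at x)" for x
        using real_analytic_deriv(2)[OF Suc.prems] by (simp add: has_field_derivative_def)
      show "Ck_on k (\<lambda>x. deriv F x * v) UNIV" for v
        by (intro Ck_on_mult Ck_on_const Suc real_analytic_deriv(1) open_UNIV)
    qed
  qed
  with assms show ?thesis by (simp add: smooth_on_def)
qed

section \<open>Systems with chained coordinates\<close>

lemma linear_axis_expansion:
  fixes T :: "real^'n \<Rightarrow> 'b::real_vector"
  assumes "linear T"
  shows "T v = (\<Sum>i\<in>UNIV. v $ i *\<^sub>R T (axis i 1))"
proof -
  interpret linear T by fact
  have "T (\<Sum>i\<in>UNIV. v $ i *s axis i 1) = (\<Sum>i\<in>UNIV. v $ i *\<^sub>R T (axis i 1))"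
    by (simp only: sum scale scalar_mult_eq_scaleR)
  then show ?thesis by (simp only: basis_expansion)
qed

lemma frechet_derivative_vec_nth:
  assumes "P differentiable (at x)"
  shows "frechet_derivative (\<lambda>x. P x $ i) (at x) v = frechet_derivative P (at x) v $ i"
proof -
  have "((\<lambda>x. P x $ i) has_derivative (\<lambda>v. frechet_derivative P (at x) v $ i)) (at x)"
    using assms bounded_linear.has_derivative[OF bounded_linear_vec_nth]
    by (simp add: frechet_derivative_works)
  from frechet_derivative_at[OF this] show ?thesis by metis
qed

text \<open>Independence of a coordinate is expressed below as invariance under translations along
  its axis, a form that passes directly to the derivative.\<close>

lemma frechet_derivative_periodic:
  assumes "\<And>y. h (y + c) = h y" "h differentiable (at (x + c))"
  shows "frechet_derivative h (at (x + c)) = frechet_derivative h (at x)"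
proof -
  have "((\<lambda>y. h (y + c)) has_derivative frechet_derivative h (at (x + c))) (at x)"
    by (rule has_derivative_compose[of "\<lambda>y. y + c" "\<lambda>v. v"])
      (use assms(2) in \<open>auto simp: frechet_derivative_works intro!: derivative_eq_intros\<close>)
  then have "(h has_derivative frechet_derivative h (at (x + c))) (at x)"
    by (simp add: assms(1))
  from frechet_derivative_at[OF this] show ?thesis .
qed

lemma frechet_derivative_invariant_direction:
  assumes "\<And>t::real. h (x + t *\<^sub>R w) = h x" "h differentiable (at x)"
  shows "frechet_derivative h (at x) w = 0"
proof -
  have "(h has_derivative frechet_derivative h (at x)) (at (x + 0 *\<^sub>R w))"
    using assms(2) by (simp add: frechet_derivative_works)
  then have "((\<lambda>t::real. h (x + t *\<^sub>R w)) has_derivative (\<lambda>t. frechet_derivative h (at x) (t *\<^sub>R w))) (at 0)"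
    by (rule has_derivative_compose[rotated]) (auto intro!: derivative_eq_intros)
  then have "((\<lambda>t::real. h x) has_derivative (\<lambda>t. frechet_derivative h (at x) (t *\<^sub>R w))) (at 0)"
    by (simp add: assms(1))
  from has_derivative_unique[OF this has_derivative_const] show ?thesis
    by (metis scaleR_one)
qed

lemma smooth_on_differentiable: "smooth_on f S \<Longrightarrow> x \<in> S \<Longrightarrow> f differentiable (at x)"
  unfolding smooth_on_def using Ck_on.simps(2) by metis

lemma smooth_onD: "smooth_on f S \<Longrightarrow> Ck_on k f S"
  by (simp add: smooth_on_def)

lemma smooth_on_frechet: "smooth_on f S \<Longrightarrow> smooth_on (\<lambda>x. frechet_derivative f (at x) v) S"
  unfolding smooth_on_def using Ck_on.simps(2) by metis

definition lie_deriv :: "('a::real_normed_vector \<Rightarrow> 'a) \<Rightarrow> ('a \<Rightarrow> real) \<Rightarrow> 'a \<Rightarrow> real" where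
  "lie_deriv f h x = frechet_derivative h (at x) (f x)"

lemma lie_deriv_expansion:
  fixes f :: "real^'n \<Rightarrow> real^'n"
  assumes "h differentiable (at x)"
  shows "lie_deriv f h x = (\<Sum>i\<in>UNIV. f x $ i * frechet_derivative h (at x) (axis i 1))"
  unfolding lie_deriv_def
  by (subst linear_axis_expansion[OF linear_frechet_derivative[OF assms]]) simp

text \<open>The direction \<open>f x\<close> varies with \<open>x\<close>; the expansion in
  coordinates reduces the claim to partial derivatives.\<close>

lemma smooth_on_lie_deriv:
  fixes f :: "real^'n \<Rightarrow> real^'n"
  assumes "smooth_on f UNIV" "smooth_on h UNIV"
  shows "smooth_on (lie_deriv f h) UNIV"
proof -
  have "lie_deriv f h = (\<lambda>x. \<Sum>i\<in>UNIV. f x $ i * frechet_derivative h (at x) (axis i 1))"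
    using lie_deriv_expansion smooth_on_differentiable[OF assms(2)] by blast
  moreover have "Ck_on k (\<lambda>x. \<Sum>i\<in>UNIV. f x $ i * frechet_derivative h (at x) (axis i 1)) UNIV" for k
    using assms smooth_on_frechet[OF assms(2)]
    by (intro Ck_on_sum Ck_on_mult open_UNIV) (simp_all add: smooth_on_def Ck_on_vec)
  ultimately show ?thesis by (simp add: smooth_on_def)
qed

text \<open>
  The coordinate \<open>chain r k\<close> has distance \<open>k\<close> from the output \<open>chain r 0\<close>, and the control
  enters at the far end. By \<open>shift_f\<close> the drift moves information at most one step closer to
  the output within a chain, and at least one step further away when passing to another chain.
\<close>

locale chained_system =
  fixes f :: "real^'N \<Rightarrow> real^'N"
    and chain :: "'r::finite \<Rightarrow> nat \<Rightarrow> 'N"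
    and len :: "'r \<Rightarrow> nat"
    and side :: "'N \<Rightarrow> 'r"
    and idx :: "'N \<Rightarrow> nat"
  assumes smooth_f: "smooth_on f UNIV"
    and len_pos: "0 < len r"
    and len_le: "len s \<le> len r + 2"
    and idx_less: "idx i < len (side i)"
    and chain_idx: "chain (side i) (idx i) = i"
    and side_chain: "k < len r \<Longrightarrow> side (chain r k) = r"
    and idx_chain: "k < len r \<Longrightarrow> idx (chain r k) = k"
    and shift_f: "\<not> (if side l = side i then idx l \<le> Suc (idx i) else idx l < idx i) \<Longrightarrow>
      f (x + t *\<^sub>R axis l 1) $ i = f x $ i"
    and deriv_f: "Suc k < len r \<Longrightarrow>
      frechet_derivative f (at x) (axis (chain r (Suc k)) 1) $ chain r k \<noteq> 0"
begin

section \<open>Iterated Lie derivatives of the outputs\<close>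

definition observable :: "'r \<Rightarrow> nat \<Rightarrow> real^'N \<Rightarrow> real" where
  "observable r j = (lie_deriv f ^^ j) (\<lambda>x. x $ chain r 0)"

lemma observable_0: "observable r 0 = (\<lambda>x. x $ chain r 0)"
  and observable_Suc: "observable r (Suc j) = lie_deriv f (observable r j)"
  by (simp_all add: observable_def)

lemma smooth_observable: "smooth_on (observable r j) UNIV"
proof (induction j)
  case 0
  show ?case
    unfolding observable_0 smooth_on_def by (auto intro: Ck_on_linear bounded_linear_vec_nth)
next
  case (Suc j)
  then show ?case unfolding observable_Suc by (rule smooth_on_lie_deriv[OF smooth_f])
qed

lemmas differentiable_observable = smooth_on_differentiable[OF smooth_observable UNIV_I]

lemma observable_Suc_expansion:
  "observable r (Suc j) x = (\<Sum>i\<in>UNIV. f x $ i * frechet_derivative (observable r j) (at x) (axis i 1))"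
  unfolding observable_Suc by (rule lie_deriv_expansion[OF differentiable_observable])

text \<open>One more derivative reaches one step further within a chain. Crossing from depth at most
  \<open>j\<close> in chain \<open>r\<close> to another chain leads to depth below \<open>j\<close>,
  hence the lag of two after \<open>Suc j\<close> derivatives; later steps preserve it.\<close>

lemma shift_observable:
  "\<not> (if side l = r then idx l \<le> j else idx l + 2 \<le> j) \<Longrightarrow>
    observable r j (x + t *\<^sub>R axis l 1) = observable r j x"
proof (induction j arbitrary: x l t)
  case 0
  then have "l \<noteq> chain r 0"
    using side_chain[OF len_pos, of r] idx_chain[OF len_pos, of r] by auto
  then show ?case
    by (simp add: observable_0 axis_def)
next
  case (Suc j)
  have inv: "observable r j (y + t *\<^sub>R axis l 1) = observable r j y" for y
    using Suc.prems by (intro Suc.IH) (auto split: if_splits)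
  have D: "frechet_derivative (observable r j) (at (x + t *\<^sub>R axis l 1)) =
      frechet_derivative (observable r j) (at x)"
    by (rule frechet_derivative_periodic[OF inv differentiable_observable])
  \<comment> \<open>Either the component \<open>i\<close> of the drift does not see
    \<open>l\<close>, or its factor, the partial derivative in direction \<open>i\<close>,
    vanishes.\<close>
  have "f (x + t *\<^sub>R axis l 1) $ i * frechet_derivative (observable r j) (at x) (axis i 1) =
      f x $ i * frechet_derivative (observable r j) (at x) (axis i 1)" for i
  proof (cases "if side i = r then idx i \<le> j else idx i + 2 \<le> j")
    case True
    then have "f (x + t *\<^sub>R axis l 1) $ i = f x $ i"
      using Suc.prems by (intro shift_f) (auto split: if_splits)
    then show ?thesis by simp
  next
    case False
    then have "frechet_derivative (observable r j) (at x) (axis i 1) = 0"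
      by (intro frechet_derivative_invariant_direction Suc.IH differentiable_observable) auto
    then show ?thesis by simp
  qed
  then show ?case
    unfolding observable_Suc_expansion D by (simp only:)
qed

lemma deriv_observable_eq_0:
  assumes "\<not> (if side l = r then idx l \<le> j else idx l + 2 \<le> j)"
  shows "frechet_derivative (observable r j) (at x) (axis l 1) = 0"
  using shift_observable[OF assms]
  by (intro frechet_derivative_invariant_direction differentiable_observable)

text \<open>Differentiating the expansion of \<open>observable r (Suc j)\<close> in the direction of
  \<open>chain r (Suc j)\<close> leaves a single term: the coefficient from \<open>deriv_f\<close>
  times the partial derivative of the induction hypothesis.\<close>

lemma deriv_observable_neq_0:
  "j < len r \<Longrightarrow> frechet_derivative (observable r j) (at x) (axis (chain r j) 1) \<noteq> 0"
proof (induction j)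
  case 0
  have "((\<lambda>x. x $ chain r 0) has_derivative (\<lambda>v. v $ chain r 0)) (at x)"
    using bounded_linear_imp_has_derivative bounded_linear_vec_nth by blast
  from frechet_derivative_at[OF this]
  have "frechet_derivative (observable r 0) (at x) = (\<lambda>v. v $ chain r 0)"
    unfolding observable_0 by (rule sym)
  then show ?case by simp
next
  case (Suc j)
  define l where "l = chain r (Suc j)"
  have l: "side l = r" "idx l = Suc j"
    using Suc.prems by (simp_all add: l_def side_chain idx_chain)
  let ?h = "observable r j"
  let ?d = "\<lambda>i x. frechet_derivative ?h (at x) (axis i 1)"
  have d: "smooth_on (?d i) UNIV" for i
    by (rule smooth_on_frechet[OF smooth_observable])
  \<comment> \<open>These are mixed second derivatives; \<open>?h\<close> does not depend on the
    coordinate \<open>l\<close>.\<close>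
  have d0: "frechet_derivative (?d i) (at x) (axis l 1) = 0" for i
  proof (rule frechet_derivative_invariant_direction)
    show "?d i (x + t *\<^sub>R axis l 1) = ?d i x" for t
      by (subst frechet_derivative_periodic) (auto intro!: shift_observable differentiable_observable simp: l)
    show "?d i differentiable (at x)"
      by (rule smooth_on_differentiable[OF d UNIV_I])
  qed
  have "((\<lambda>x. \<Sum>i\<in>UNIV. f x $ i * ?d i x) has_derivative
      (\<lambda>v. \<Sum>i\<in>UNIV. f x $ i * frechet_derivative (?d i) (at x) v +
        frechet_derivative f (at x) v $ i * ?d i x)) (at x)"
  proof (intro has_derivative_sum has_derivative_mult)
    show "((\<lambda>x. f x $ i) has_derivative (\<lambda>v. frechet_derivative f (at x) v $ i)) (at x)" for i
      using smooth_on_differentiable[OF smooth_f UNIV_I, of x]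
      by (intro bounded_linear.has_derivative[OF bounded_linear_vec_nth])
        (simp add: frechet_derivative_works)
    show "(?d i has_derivative frechet_derivative (?d i) (at x)) (at x)" for i
      using smooth_on_differentiable[OF d UNIV_I, of i x] frechet_derivative_works by blast
  qed
  from frechet_derivative_at[OF this]
  have "frechet_derivative (observable r (Suc j)) (at x) =
      (\<lambda>v. \<Sum>i\<in>UNIV. f x $ i * frechet_derivative (?d i) (at x) v +
        frechet_derivative f (at x) v $ i * ?d i x)"
    unfolding observable_Suc_expansion[abs_def] by (rule sym)
  then have "frechet_derivative (observable r (Suc j)) (at x) (axis l 1) =
      (\<Sum>i\<in>UNIV. frechet_derivative f (at x) (axis l 1) $ i * ?d i x)"
    by (simp add: d0)
  also have "\<dots> = (\<Sum>i\<in>UNIV. if i = chain r j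
      then frechet_derivative f (at x) (axis l 1) $ i * ?d i x else 0)"
  proof (intro sum.cong refl)
    fix i
    \<comment> \<open>Where the partial derivative of \<open>?h\<close> may be nonzero,
      \<open>i\<close> lies strictly below \<open>j\<close> in chain \<open>r\<close> or at least
      two below in another chain, too far from \<open>l\<close> for the drift to connect
      them.\<close>
    have "frechet_derivative f (at x) (axis l 1) $ i * ?d i x = 0" if i: "i \<noteq> chain r j"
    proof (cases "if side i = r then idx i \<le> j else idx i + 2 \<le> j")
      case True
      have "idx i \<noteq> j" if "side i = r"
        using i chain_idx[of i] that by auto
      with True have "\<not> (if side l = side i then idx l \<le> Suc (idx i) else idx l < idx i)"
        by (auto simp: l split: if_splits)
      then have "frechet_derivative (\<lambda>x. f x $ i) (at x) (axis l 1) = 0"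
        using smooth_f smooth_on_differentiable[of "\<lambda>x. f x $ i" UNIV x]
        by (intro frechet_derivative_invariant_direction shift_f) (simp_all add: smooth_on_def Ck_on_vec)
      then show ?thesis
        using frechet_derivative_vec_nth[OF smooth_on_differentiable[OF smooth_f UNIV_I]] by simp
    next
      case False
      then show ?thesis by (simp add: deriv_observable_eq_0)
    qed
    then show "frechet_derivative f (at x) (axis l 1) $ i * ?d i x =
      (if i = chain r j then frechet_derivative f (at x) (axis l 1) $ i * ?d i x else 0)"
      by auto
  qed
  also have "\<dots> = frechet_derivative f (at x) (axis l 1) $ chain r j * ?d (chain r j) x"
    by simp
  finally show ?case
    using Suc deriv_f[of j r x] by (simp add: l_def)
qed

section \<open>The change of coordinates and its Jacobian\<close>

definition transform :: "real^'N \<Rightarrow> real^'N" where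
  "transform x = (\<chi> i. observable (side i) (idx i) x)"

lemma smooth_transform: "smooth_on transform UNIV"
  using smooth_observable unfolding smooth_on_def by (simp add: Ck_on_vec transform_def)

lemma frechet_transform:
  "frechet_derivative transform (at x) v $ i = frechet_derivative (observable (side i) (idx i)) (at x) v"
  using frechet_derivative_vec_nth[OF smooth_on_differentiable[OF smooth_transform UNIV_I], of i x v]
  by (simp add: transform_def)

lemma linear_frechet_transform: "linear (frechet_derivative transform (at x))"
  by (rule linear_frechet_derivative[OF smooth_on_differentiable[OF smooth_transform UNIV_I]])

text \<open>The Jacobian is triangular with respect to \<open>idx\<close>: row \<open>i\<close>
  involves only \<open>i\<close> itself, with a nonzero coefficient, and coordinates of smaller
  \<open>idx\<close>.\<close>

lemma frechet_transform_inj: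
  assumes "frechet_derivative transform (at x) v = 0"
  shows "v = 0"
proof -
  have "v $ i = 0" for i
  proof (induction "idx i" arbitrary: i rule: less_induct)
    case less
    let ?D = "frechet_derivative (observable (side i) (idx i)) (at x)"
    have z: "v $ l * ?D (axis l 1) = 0" if "l \<noteq> i" for l
    proof (cases "idx l < idx i")
      case False
      then have "\<not> (side l = side i \<and> idx l \<le> idx i)"
        using chain_idx[of l] chain_idx[of i] that by (metis le_antisym not_less)
      with False show ?thesis by (auto simp: deriv_observable_eq_0)
    qed (simp add: less)
    have "0 = ?D v"
      using assms frechet_transform[of x v i] by simp
    also have "\<dots> = (\<Sum>l\<in>UNIV. v $ l * ?D (axis l 1))"
      by (subst linear_axis_expansion[OF linear_frechet_derivative[OF differentiable_observable]]) simp
    also have "\<dots> = v $ i * ?D (axis i 1)"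
      by (subst sum.remove[of UNIV i]) (auto simp: z)
    finally show "v $ i = 0"
      using deriv_observable_neq_0[OF idx_less[of i], of x] by (simp add: chain_idx)
  qed
  then show ?thesis by (simp add: vec_eq_iff)
qed

section \<open>Controls at the chain ends and the decoupling matrix\<close>

definition final :: "'r \<Rightarrow> 'N" where
  "final r = chain r (len r - 1)"

lemma side_final: "side (final r) = r" and idx_final: "idx (final r) = len r - 1"
  using len_pos[of r] by (simp_all add: final_def side_chain idx_chain)

lemma final_eq_iff: "final r = final s \<longleftrightarrow> r = s"
  using side_final by metis

lemma final_cases:
  obtains "Suc (idx i) < len (side i)" "\<And>r. i \<noteq> final r" | "i = final (side i)"
proof (cases "Suc (idx i) < len (side i)")
  case True
  have "i \<noteq> final r" for r
    using True side_final[of r] idx_final[of r] by auto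
  with True show ?thesis by (rule that(1))
next
  case False
  then have "idx i = len (side i) - 1"
    using idx_less[of i] by simp
  then show ?thesis using that(2) chain_idx[of i] by (simp add: final_def)
qed

definition inputs :: "real^'r^'N" where
  "inputs = (\<chi> i r. if i = final r then 1 else 0)"

text \<open>Entry \<open>(s, r)\<close> is the Lie derivative along control \<open>r\<close> of the
  last new coordinate of chain \<open>s\<close>.\<close>

definition decoupling :: "real^'N \<Rightarrow> real^'r^'r" where
  "decoupling x = (\<chi> s r. frechet_derivative transform (at x) (axis (final r) 1) $ final s)"

lemma inputs_mult: "inputs *v w = (\<Sum>r\<in>UNIV. w $ r *\<^sub>R axis (final r) 1)"
  by (auto simp: inputs_def vec_eq_iff matrix_vector_mult_def axis_def intro!: sum.cong)

text \<open>The controls leave every row but the final ones untouched, since a chain end is too deep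
  for the lower observables to see.\<close>

lemma frechet_transform_inputs:
  "frechet_derivative transform (at x) (inputs *v w) $ i =
    (if i = final (side i) then (decoupling x *v w) $ side i else 0)"
proof -
  interpret D: linear "frechet_derivative transform (at x)"
    by (rule linear_frechet_transform)
  have eq: "frechet_derivative transform (at x) (inputs *v w) $ i =
    (\<Sum>r\<in>UNIV. w $ r * frechet_derivative transform (at x) (axis (final r) 1) $ i)"
    by (simp add: inputs_mult D.sum D.scale)
  show ?thesis
  proof (cases rule: final_cases[of i])
    case 1
    \<comment> \<open>For another chain \<open>r\<close>, seeing \<open>final r\<close> would need
      \<open>len r + 1 \<le> idx i\<close>, whereas \<open>len_le\<close> gives
      \<open>idx i \<le> len (side i) - 2 \<le> len r\<close>.\<close>
    have "frechet_derivative transform (at x) (axis (final r) 1) $ i = 0" for r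
      unfolding frechet_transform using 1(1) len_le[of "side i" r] len_pos[of r]
      by (intro deriv_observable_eq_0) (auto simp: side_final idx_final)
    with 1 show ?thesis by (simp add: eq)
  next
    case 2
    then show ?thesis
      unfolding eq by (simp add: decoupling_def matrix_vector_mult_def mult.commute)
  qed
qed

text \<open>A kernel vector \<open>w\<close> makes the Jacobian vanish on
  \<open>inputs *v w\<close>, as the nonfinal rows vanish anyway. The Jacobian is injective and the
  columns of \<open>inputs\<close> are independent.\<close>

lemma invertible_decoupling: "invertible (decoupling x)"
  unfolding invertible_left_inverse matrix_left_invertible_ker
proof (intro allI impI)
  fix w assume "decoupling x *v w = 0"
  then have "frechet_derivative transform (at x) (inputs *v w) = 0"
    by (simp add: vec_eq_iff frechet_transform_inputs)
  then have 0: "inputs *v w = 0"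
    by (rule frechet_transform_inj)
  have "w $ r = (inputs *v w) $ final r" for r
  proof -
    have "(inputs *v w) $ final r = (\<Sum>s\<in>UNIV. if s = r then w $ s else 0)"
      by (simp add: inputs_mult axis_def final_eq_iff if_distrib cong: if_cong)
    then show ?thesis by simp
  qed
  then show "w = 0" by (simp add: 0 vec_eq_iff)
qed

theorem linearizable: "locally_state_feedback_linearizable f (\<lambda>x. inputs) x0"
proof -
  obtain U V Q where x0: "x0 \<in> U" and diffeo: "diffeomorphism U V transform Q"
    by (rule smooth_inverse_function[OF smooth_transform frechet_transform_inj])
  have U: "open U" and PQ: "\<And>y. y \<in> V \<Longrightarrow> transform (Q y) = y"
    using diffeo unfolding diffeomorphism_def homeomorphism_def by auto
  let ?D = "\<lambda>x. frechet_derivative transform (at x)"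
  \<comment> \<open>\<open>\<beta>\<close> inverts the decoupling matrix, so that the new controls
    enter the final rows as unit vectors; \<open>\<alpha>\<close> cancels the top derivatives
    \<open>observable s (len s)\<close>.\<close>
  define \<beta> where "\<beta> x = matrix_inv (decoupling x)" for x
  define \<alpha> where "\<alpha> x = - (\<beta> x *v (\<chi> s. observable s (len s) x))" for x
  \<comment> \<open>The shift along each chain, with zero rows at the chain ends.\<close>
  define A :: "real^'N^'N" where
    "A = (\<chi> i l. if Suc (idx i) < len (side i) \<and> l = chain (side i) (Suc (idx i)) then 1 else 0)"
  have \<beta>: "decoupling x ** \<beta> x = mat 1" for x
    unfolding \<beta>_def by (rule invertible_matrix_inv(1)[OF invertible_decoupling])
  have Ck_\<beta>: "Ck_on k \<beta> U" for k
    unfolding \<beta>_def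
  proof (rule Ck_on_matrix_inv[OF U _ invertible_decoupling])
    show "Ck_on k (\<lambda>x. decoupling x $ i $ j) U" for i j
      unfolding decoupling_def frechet_transform vec_lambda_beta
      by (rule Ck_on_subset[OF smooth_onD[OF smooth_on_frechet[OF smooth_observable]] subset_UNIV])
  qed
  have "Ck_on k \<alpha> U" for k
  proof -
    have "Ck_on k (\<lambda>x. (-1) *\<^sub>R (\<Sum>s\<in>UNIV. \<beta> x $ i $ s * observable s (len s) x)) U" for i
    proof (intro Ck_on_scaleR Ck_on_const Ck_on_sum Ck_on_mult U)
      show "Ck_on k (\<lambda>x. \<beta> x $ i $ s) U" for s
        using Ck_\<beta> by (simp add: Ck_on_vec[OF U])
      show "Ck_on k (observable s (len s)) U" for s
        by (rule Ck_on_subset[OF smooth_onD[OF smooth_observable] subset_UNIV])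
    qed
    then show ?thesis
      by (simp add: Ck_on_vec[OF U] \<alpha>_def matrix_vector_mult_def)
  qed
  then have smooth: "smooth_on \<alpha> U" "smooth_on \<beta> U"
    using Ck_\<beta> by (auto simp: smooth_on_def)
  have inv: "invertible (\<beta> x)" for x
    unfolding \<beta>_def invertible_def
    using invertible_matrix_inv[OF invertible_decoupling[of x]] by blast
  have drift: "?D x (f x + inputs *v \<alpha> x) = A *v transform x" for x
  proof -
    have "?D x (f x + inputs *v \<alpha> x) $ i = (A *v transform x) $ i" for i
    proof -
      \<comment> \<open>The drift turns each new coordinate into the next Lie derivative: the next
        coordinate in a nonfinal row, the term that \<open>\<alpha>\<close> cancels in a final
        one.\<close>
      have "?D x (f x + inputs *v \<alpha> x) $ i =
          observable (side i) (Suc (idx i)) x + ?D x (inputs *v \<alpha> x) $ i"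
        using linear_add[OF linear_frechet_transform]
        by (simp add: frechet_transform observable_Suc lie_deriv_def)
      also have "\<dots> = (A *v transform x) $ i"
      proof (cases rule: final_cases[of i])
        case 1
        have "(A *v transform x) $ i = transform x $ chain (side i) (Suc (idx i))"
          using 1 by (simp add: A_def matrix_vector_mult_def if_distrib if_distribR cong: if_cong)
        with 1 show ?thesis
          by (simp add: frechet_transform_inputs transform_def side_chain idx_chain)
      next
        case 2
        then have i: "Suc (idx i) = len (side i)"
          using idx_final[of "side i"] len_pos[of "side i"] by simp
        have "decoupling x *v \<alpha> x = - (\<chi> s. observable s (len s) x)"
          unfolding \<alpha>_def linear_neg[OF matrix_vector_mul_linear] matrix_vector_mul_assoc \<beta> by simp
        moreover have "(A *v transform x) $ i = 0"
          using i by (simp add: A_def matrix_vector_mult_def)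
        ultimately show ?thesis
          unfolding frechet_transform_inputs if_P[OF 2] i by simp
      qed
      finally show ?thesis .
    qed
    then show ?thesis by (simp add: vec_eq_iff)
  qed
  have input: "?D x (column j (inputs ** \<beta> x)) = column j inputs" for x j
  proof -
    have "column j (inputs ** \<beta> x) = inputs *v column j (\<beta> x)"
      by (simp add: column_def matrix_matrix_mult_def matrix_vector_mult_def vec_eq_iff)
    moreover have "decoupling x *v column j (\<beta> x) = column j (mat 1)"
      unfolding \<beta>[of x, symmetric]
      by (simp add: column_def matrix_matrix_mult_def matrix_vector_mult_def vec_eq_iff)
    ultimately have "?D x (column j (inputs ** \<beta> x)) $ i =
        (if i = final (side i) then column j (mat 1) $ side i else 0)" for i
      by (simp only: frechet_transform_inputs)
    moreover have "i = final (side i) \<and> side i = j \<longleftrightarrow> i = final j" for i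
      using side_final by auto
    ultimately have "?D x (column j (inputs ** \<beta> x)) $ i = column j inputs $ i" for i
      by (auto simp: column_def mat_def inputs_def)
    then show ?thesis by (simp add: vec_eq_iff)
  qed
  show ?thesis
    unfolding locally_state_feedback_linearizable_def pushforward_def
    using x0 diffeo smooth inv drift input PQ
    by (intro exI[of _ U] exI[of _ V] exI[of _ \<alpha>] exI[of _ \<beta>] exI[of _ transform] exI[of _ Q]
        exI[of _ A] exI[of _ inputs]) simp
qed

end

section \<open>The chain of particles\<close>

locale particle_chain =
  fixes n :: nat and e :: "nat \<Rightarrow> 'n::finite"
  assumes n_ge_2: "n \<ge> 2" and bij_e: "bij_betw e {1..n} UNIV"
begin

section \<open>Numbering of the particles and the drift in coordinates\<close>

definition num :: "'n \<Rightarrow> nat" where "num = inv_into {1..n} e"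

lemma e_num [simp]: "e (num a) = a"
  unfolding num_def using bij_e bij_betw_inv_into_right by fastforce

lemma num_bounds: "1 \<le> num a" "num a \<le> n"
  unfolding num_def using inv_into_into[of a e "{1..n}"] bij_e by (auto simp: bij_betw_def)

lemma num_e [simp]: "1 \<le> k \<Longrightarrow> k \<le> n \<Longrightarrow> num (e k) = k"
  unfolding num_def using bij_e bij_betw_inv_into_left by fastforce

lemma e_eq_iff: "1 \<le> k \<Longrightarrow> k \<le> n \<Longrightarrow> e k = a \<longleftrightarrow> k = num a"
  using num_e[of k] by auto

lemma e_inject: "1 \<le> j \<Longrightarrow> j \<le> n \<Longrightarrow> 1 \<le> k \<Longrightarrow> k \<le> n \<Longrightarrow> e j = e k \<longleftrightarrow> j = k"
  by (metis num_e)

lemma eq_e_iff: "1 \<le> k \<Longrightarrow> k \<le> n \<Longrightarrow> a = e k \<longleftrightarrow> num a = k"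
  using num_e[of k] by auto

lemma drift_Inl: "drift \<phi> n e x $ Inl a = x $ Inr a"
proof -
  have "(\<Sum>k=1..n. mom e x k *\<^sub>R d_pos e k) $ Inl a =
      (\<Sum>k=1..n. if k = num a then x $ Inr a else 0)"
    unfolding sum_component
    by (intro sum.cong) (auto simp: mom_def d_pos_def axis_def e_eq_iff)
  then show ?thesis
    using num_bounds[of a] by (simp add: drift_def d_mom_def axis_def)
qed

text \<open>Merges the two end terms and the interior sum of the drift: a missing neighbour exerts
  no force.\<close>

lemma drift_Inr:
  "drift \<phi> n e x $ Inr a =
    (if 1 < num a then \<phi> (x $ Inl (e (num a - 1)) - x $ Inl a) else 0) -
    (if num a < n then \<phi> (x $ Inl a - x $ Inl (e (num a + 1))) else 0)"
proof -
  let ?F = "\<lambda>k. \<phi> (pos e x (k - 1) - pos e x k) - \<phi> (pos e x k - pos e x (k + 1))"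
  have "(\<Sum>k=2..n-1. ?F k *\<^sub>R d_mom e k) $ Inr a = (\<Sum>k=2..n-1. if k = num a then ?F k else 0)"
    unfolding sum_component
    by (intro sum.cong) (auto simp: d_mom_def axis_def e_eq_iff)
  also have "\<dots> = (if 2 \<le> num a \<and> num a \<le> n - 1 then ?F (num a) else 0)"
    by simp
  finally have mid: "(\<Sum>k=2..n-1. ?F k *\<^sub>R d_mom e k) $ Inr a =
    (if 2 \<le> num a \<and> num a \<le> n - 1 then ?F (num a) else 0)" .
  have ends: "d_mom e 1 $ Inr a = (if num a = 1 then 1 else 0)"
    "d_mom e n $ Inr a = (if num a = n then 1 else 0)"
    using n_ge_2 eq_e_iff[of 1 a] eq_e_iff[of n a] by (simp_all add: d_mom_def axis_def)
  have "(\<Sum>k=1..n. mom e x k *\<^sub>R d_pos e k) $ Inr a = 0"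
    by (simp add: d_pos_def axis_def)
  then have "drift \<phi> n e x $ Inr a =
      - (if num a = 1 then \<phi> (pos e x 1 - pos e x 2) else 0)
      + (if 2 \<le> num a \<and> num a \<le> n - 1 then ?F (num a) else 0)
      + (if num a = n then \<phi> (pos e x (n - 1) - pos e x n) else 0)"
    unfolding drift_def vector_add_component vector_minus_component vector_scaleR_component mid ends
    by simp
  also have "\<dots> = (if 1 < num a then \<phi> (pos e x (num a - 1) - pos e x (num a)) else 0) -
    (if num a < n then \<phi> (pos e x (num a) - pos e x (num a + 1)) else 0)"
    using num_bounds[of a] n_ge_2 by (auto simp: numeral_2_eq_2)
  finally show ?thesis by (simp add: pos_def)
qed

lemma smooth_drift:
  assumes "smooth_on \<phi> UNIV"
  shows "smooth_on (drift \<phi> n e) UNIV"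
proof -
  have "Ck_on k (\<lambda>x. drift \<phi> n e x $ i) UNIV" for k i
  proof (cases i)
    case (Inl a)
    then show ?thesis
      using Ck_on_linear[OF bounded_linear_vec_nth open_UNIV] by (simp add: drift_Inl)
  next
    case (Inr a)
    have "Ck_on k (\<lambda>x :: real^('n + 'n). x $ Inl a - x $ Inl b) UNIV" for a b
      by (intro Ck_on_linear bounded_linear_sub bounded_linear_vec_nth open_UNIV)
    then have "Ck_on k (\<lambda>x :: real^('n + 'n). \<phi> (x $ Inl a - x $ Inl b)) UNIV" for a b
      by (rule Ck_on_compose[OF open_UNIV subset_UNIV smooth_onD[OF assms]])
    then have "Ck_on k (\<lambda>x :: real^('n + 'n). if c then \<phi> (x $ Inl a - x $ Inl b) else 0) UNIV" for a b c
      by (cases c) (simp_all add: Ck_on_const)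
    then show ?thesis
      unfolding Inr drift_Inr by (intro Ck_on_diff open_UNIV)
  qed
  then show ?thesis by (simp add: smooth_on_def Ck_on_vec)
qed

lemma has_derivative_drift_Inr:
  assumes "\<And>y. (\<phi> has_real_derivative \<phi>' y) (at y)"
  shows "((\<lambda>x. drift \<phi> n e x $ Inr a) has_derivative (\<lambda>v.
    (if 1 < num a then (v $ Inl (e (num a - 1)) - v $ Inl a) *
      \<phi>' (x $ Inl (e (num a - 1)) - x $ Inl a) else 0) -
    (if num a < n then (v $ Inl a - v $ Inl (e (num a + 1))) *
      \<phi>' (x $ Inl a - x $ Inl (e (num a + 1))) else 0))) (at x)"
proof -
  have *: "((\<lambda>x :: real^('n + 'n). if c then \<phi> (x $ Inl a - x $ Inl b) else 0) has_derivative
      (\<lambda>v. if c then (v $ Inl a - v $ Inl b) * \<phi>' (x $ Inl a - x $ Inl b) else 0)) (at x)" for a b c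
  proof (cases c)
    case True
    have "((\<lambda>x :: real^('n + 'n). x $ Inl a - x $ Inl b) has_derivative (\<lambda>v. v $ Inl a - v $ Inl b)) (at x)"
      by (intro bounded_linear_imp_has_derivative bounded_linear_sub bounded_linear_vec_nth)
    from DERIV_compose_FDERIV[OF assms this] True show ?thesis by simp
  qed simp
  show ?thesis unfolding drift_Inr by (intro has_derivative_diff *)
qed

section \<open>Division of the state coordinates into two chains\<close>

definition half :: nat where "half = (n + 1) div 2"

lemma half_bounds: "1 \<le> half" "half < n" "2 * half \<le> n + 1" "n \<le> 2 * half"
  using n_ge_2 by (auto simp: half_def)

text \<open>Chain \<open>1\<close> runs from the middle particle \<open>half\<close> down to particle \<open>1\<close>, chain \<open>2\<close> from
  \<open>half + 1\<close> up to particle \<open>n\<close>, each alternating positions and momenta.\<close>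

definition depth :: "'n \<Rightarrow> nat" where
  "depth a = (if num a \<le> half then half - num a else num a - half - 1)"

definition side :: "'n + 'n \<Rightarrow> 2" where
  "side i = (if num (case_sum id id i) \<le> half then 1 else 2)"

text \<open>A position precedes the momentum of its particle because one derivative leads from the
  former to the latter, and a second one to the position of the next particle.\<close>

definition idx :: "'n + 'n \<Rightarrow> nat" where
  "idx i = case_sum (\<lambda>a. 2 * depth a) (\<lambda>a. Suc (2 * depth a)) i"

definition len :: "2 \<Rightarrow> nat" where
  "len r = (if r = 1 then 2 * half else 2 * (n - half))"

definition particle :: "2 \<Rightarrow> nat \<Rightarrow> nat" where
  "particle r d = (if r = 1 then half - d else half + 1 + d)"

definition chain :: "2 \<Rightarrow> nat \<Rightarrow> 'n + 'n" where
  "chain r k = (if even k then Inl else Inr) (e (particle r (k div 2)))"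

text \<open>Within the length of a chain the truncated subtraction in \<open>particle\<close> is
  exact.\<close>

lemma particle_bounds:
  assumes "k < len r"
  shows "1 \<le> particle r (k div 2)" "particle r (k div 2) \<le> n"
  using assms half_bounds by (auto simp: len_def particle_def split: if_splits)

text \<open>Consecutive particles of a chain differ by one in depth, and the only link between the
  chains joins two particles of depth \<open>0\<close>. The two lengths are equal for even
  \<open>n\<close> and differ by two for odd \<open>n\<close>.\<close>

lemma chained_system_drift:
  assumes smooth: "smooth_on \<phi> UNIV"
    and \<phi>': "\<And>y. (\<phi> has_real_derivative \<phi>' y) (at y)" and nz: "\<And>y. \<phi>' y \<noteq> 0"
  shows "chained_system (drift \<phi> n e) chain len side idx"
proof
  show "smooth_on (drift \<phi> n e) UNIV"
    by (rule smooth_drift[OF smooth])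
  show "0 < len r" "len s \<le> len r + 2" for r s
    using half_bounds by (auto simp: len_def)
  show "idx i < len (side i)" for i
  proof -
    define a where "a = case_sum id id i"
    have "depth a < (if num a \<le> half then half else n - half)"
      using half_bounds num_bounds[of a] by (auto simp: depth_def)
    then have "Suc (2 * depth a) < len (side i)"
      by (auto simp: len_def side_def a_def)
    moreover have "idx i \<le> Suc (2 * depth a)"
      by (cases i) (simp_all add: idx_def a_def)
    ultimately show ?thesis by simp
  qed
  show "chain (side i) (idx i) = i" for i
    using num_bounds by (cases i) (auto simp: idx_def chain_def particle_def side_def depth_def)
  show "side (chain r k) = r" if k: "k < len r" for r k
  proof -
    have "side (chain r k) = (if particle r (k div 2) \<le> half then 1 else 2)"
      using particle_bounds[OF k] by (simp add: side_def chain_def)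
    then show ?thesis
      using exhaust_2[of r] half_bounds by (auto simp: particle_def)
  qed
  show "idx (chain r k) = k" if k: "k < len r" for r k
  proof -
    have "idx (chain r k) = (if even k then 2 * depth (e (particle r (k div 2)))
        else Suc (2 * depth (e (particle r (k div 2)))))"
      by (simp add: idx_def chain_def)
    moreover have "depth (e (particle r (k div 2))) = k div 2"
      using particle_bounds[OF k] k half_bounds by (auto simp: depth_def particle_def len_def split: if_splits)
    ultimately show ?thesis by simp
  qed
  show "drift \<phi> n e (x + t *\<^sub>R axis l 1) $ i = drift \<phi> n e x $ i"
    if nl: "\<not> (if side l = side i then idx l \<le> Suc (idx i) else idx l < idx i)" for i l t x
  proof (cases i)
    case (Inl a)
    then have "l \<noteq> Inr a"
      using nl by (auto simp: side_def idx_def)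
    then show ?thesis by (simp add: Inl drift_Inl axis_def)
  next
    case (Inr a)
    have 1: "l \<noteq> Inl a"
      using nl by (auto simp: Inr side_def idx_def)
    \<comment> \<open>A neighbour in the same chain is at most one level deeper, so its position is
      at most one step beyond the momentum of \<open>a\<close>. Across the cut both depths are
      \<open>0\<close>, and the foreign position has \<open>idx\<close> \<open>0\<close>, below the
      \<open>1\<close> of that momentum.\<close>
    have "l \<noteq> Inl b" if "num b = num a + 1 \<or> num a = num b + 1" for b
      using nl that by (auto simp: Inr side_def idx_def depth_def split: if_splits)
    then have "1 < num a \<Longrightarrow> l \<noteq> Inl (e (num a - 1))" "num a < n \<Longrightarrow> l \<noteq> Inl (e (num a + 1))"
      using num_bounds[of a] by simp_all
    with 1 show ?thesis by (auto simp: Inr drift_Inr axis_def)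
  qed
  show "frechet_derivative (drift \<phi> n e) (at x) (axis (chain r (Suc k)) 1) $ chain r k \<noteq> 0"
    if k: "Suc k < len r" for r k x
  proof -
    let ?v = "axis (chain r (Suc k)) 1 :: real^('n + 'n)"
    have D: "frechet_derivative (drift \<phi> n e) (at x) ?v $ i = D ?v"
      if "((\<lambda>x. drift \<phi> n e x $ i) has_derivative D) (at x)" for i D
      using frechet_derivative_at[OF that]
        frechet_derivative_vec_nth[OF smooth_on_differentiable[OF smooth_drift[OF smooth] UNIV_I], of i x ?v]
      by simp
    show ?thesis
    proof (cases "even k")
      case True
      define a where "a = e (particle r (k div 2))"
      have "chain r k = Inl a" "chain r (Suc k) = Inr a"
        using True by (simp_all add: chain_def a_def)
      moreover have "((\<lambda>x. drift \<phi> n e x $ Inl a) has_derivative (\<lambda>v. v $ Inr a)) (at x)"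
        unfolding drift_Inl by (intro bounded_linear_imp_has_derivative bounded_linear_vec_nth)
      ultimately show ?thesis using D by simp
    next
      \<comment> \<open>From the momentum of particle \<open>j\<close> the chain goes on to the
        position of \<open>j'\<close>, its neighbour away from the cut. In both chains the
        coefficient is \<phi>' at the distance between these two particles.\<close>
      case False
      define j where "j = particle r (k div 2)"
      define j' where "j' = particle r (Suc k div 2)"
      have k2: "Suc k div 2 = Suc (k div 2)"
        using False by presburger
      have j: "1 \<le> j" "j \<le> n" "1 \<le> j'" "j' \<le> n"
        using particle_bounds[of k r] particle_bounds[of "Suc k" r] k by (auto simp: j_def j'_def)
      have c: "chain r k = Inr (e j)" "chain r (Suc k) = Inl (e j')"
        using False by (simp_all add: chain_def j_def j'_def)
      have c2: "?v $ Inl (e l) = (if l = j' then 1 else 0)" if "1 \<le> l" "l \<le> n" for l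
        using that j by (simp add: c(2) axis_def e_inject)
      have nums: "num (e j) = j"
        using j by simp
      have "j' = j - 1 \<and> 1 < j \<or> j' = j + 1 \<and> j < n"
        using j by (auto simp: j_def j'_def k2 particle_def split: if_splits)
      then consider "j = Suc j'" | "j' = Suc j" "j < n"
        by fastforce
      then have "frechet_derivative (drift \<phi> n e) (at x) ?v $ Inr (e j) \<noteq> 0"
        unfolding D[OF has_derivative_drift_Inr[OF \<phi>']] nums
        by cases (use j nz in \<open>simp_all add: c2\<close>)
      then show ?thesis unfolding c(1) .
    qed
  qed
qed

end

theorem theorem4p2:
  fixes \<Phi> \<phi> :: "real \<Rightarrow> real"
    and n :: nat
    and e :: "nat \<Rightarrow> 'n::finite"
    and x0 :: "real^('n + 'n)"
  assumes "n \<ge> 2"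
    and "bij_betw e {1..n} (UNIV :: 'n set)"
    and "real_analytic \<Phi>"
    and "bdd_below (range \<Phi>)"
    and "filterlim \<Phi> at_top at_top"
    and "\<phi> = deriv \<Phi>"
    and "\<And>y. deriv \<phi> y \<noteq> 0"
  shows "locally_state_feedback_linearizable (drift \<phi> n e) (double_forcing n e) x0"
proof -
  interpret particle_chain n e
    using assms by unfold_locales
  have \<phi>: "real_analytic \<phi>"
    using real_analytic_deriv(1) assms by blast
  interpret chained_system "drift \<phi> n e" chain len side idx
    by (rule chained_system_drift[OF real_analytic_imp_smooth[OF \<phi>] real_analytic_deriv(2)[OF \<phi>]])
      (rule assms)
  \<comment> \<open>The last slot \<open>2 * k - 1\<close> of a chain of \<open>k\<close> particles
    is the momentum at depth \<open>k - 1\<close>. This is particle \<open>1\<close> for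
    \<open>k = half\<close> in the first chain and particle \<open>n\<close> for
    \<open>k = n - half\<close> in the second, so the chain ends are exactly the forced
    momenta.\<close>
  have "(2 * k - 1) div 2 = k - 1" for k :: nat
    by presburger
  then have "final 1 = Inr (e 1)" "final 2 = Inr (e n)"
    using half_bounds by (simp_all add: final_def chain_def len_def particle_def)
  then have "double_forcing n e = (\<lambda>x. inputs)"
    by (auto simp: double_forcing_def inputs_def d_mom_def axis_def vec_eq_iff fun_eq_iff forall_2)
  then show ?thesis using linearizable by simp
qed

end
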